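(* Let $A\in\mathbb{R}^{n\times n}$ be an invertible matrix and $b\in\mathbb{R}^n$. Assume that $$\|A^{-1}\|<\tfrac13.$$ Then the inexact semi-smooth Newton sequence $\{x_k\}$ for solving $Ax-|x|=b$, given by $$\big\|[A-D(x_k)]x_{k+1}-b\big\|\le\theta\,\|F(x_k)\|,\qquad k=0,1,\ldots,$$ with any starting point $x_0\in\mathbb{R}^n$ and residual relative error tolerance $\theta\ge0$, is well defined. Moreover, if $$0\le\theta<\frac{1-3\|A^{-1}\|}{\|A^{-1}\|\,(\|A\|+3)},$$ then $\{x_k\}$ converges $Q$-linearly to $x_*\in\mathbb{R}^n$, the unique solution of $Ax-|x|=b$, as follows: $$\|x_{k+1}-x_*\|\le\frac{\|A^{-1}\|}{1-\|A^{-1}\|}\,\big[\theta\,(\|A\|+3)+2\big]\,\|x_k-x_*\|,\qquad k=0,1,\ldots.$$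
   Context: For $x\in\mathbb{R}^n$, $|x|$ is the vector with components $|x_i|$; $\operatorname{sgn}(x)$ is the vector with components $-1,0,1$ according to whether $x_i$ is negative, zero or positive; and $D(x):=\operatorname{diag}(\operatorname{sgn}(x))$ is the diagonal matrix with diagonal $\operatorname{sgn}(x)$. The function $F:\mathbb{R}^n\to\mathbb{R}^n$ is $F(x):=Ax-|x|-b$. $\|\cdot\|$ is a norm on $\mathbb{R}^n$, and for matrices $M\in\mathbb{R}^{n\times n}$, $\|M\|:=\max\{\|Mx\|: x\in\mathbb{R}^n,\ \|x\|=1\}$. The inexact semi-smooth Newton sequence is any sequence whose iterates satisfy the displayed residual inequality; it is well defined if at every iterate $x_k$ there exists a point $x_{k+1}$ satisfying this inequality. A sequence $\{x_k\}$ converges $Q$-linearly to $x_*$ if it converges to $x_*$ and there is a constant $c\in[0,1)$ with $\|x_{k+1}-x_*\|\le c\|x_k-x_*\|$ for all sufficiently large $k$.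
   Formalization: The norm is additionally assumed absolute (‖|x|‖ = ‖x‖ for all x, as for every p-norm); for a general norm the claim fails, since A − D(x_0) can be singular even though ‖A^{-1}‖ < 1/3. *)

theory Defs
  imports "HOL-Analysis.Analysis"
begin

definition is_norm :: "(real ^ 'n \<Rightarrow> real) \<Rightarrow> bool" where
  "is_norm N \<longleftrightarrow>
     (\<forall>x. 0 \<le> N x) \<and>
     (\<forall>x. N x = 0 \<longleftrightarrow> x = 0) \<and>
     (\<forall>c x. N (c *\<^sub>R x) = \<bar>c\<bar> * N x) \<and>
     (\<forall>x y. N (x + y) \<le> N x + N y)"

(* \<bar>x\<bar> is the componentwise absolute value (abs_vec_def). All p-norms are absolute.
   For a norm, absoluteness is equivalent to: every diagonal matrix with entries in
   {-1, 0, 1} has induced norm at most 1. Without it, A - sgn_diag x can be singular even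
   if the inverse of A has induced norm below 1/3. *)
definition absolute :: "(real ^ 'n \<Rightarrow> real) \<Rightarrow> bool" where
  "absolute N \<longleftrightarrow> (\<forall>x. N \<bar>x\<bar> = N x)"

(* The supremum is a maximum when N is a norm; see mat_norm_attained below. *)
definition mat_norm :: "(real ^ 'n \<Rightarrow> real) \<Rightarrow> real ^ 'n ^ 'n \<Rightarrow> real" where
  "mat_norm N M = (SUP x\<in>{x. N x = 1}. N (M *v x))"

(* sgn is applied to the components: on vectors the library's sgn is x /\<^sub>R norm x. *)
definition sgn_diag :: "real ^ 'n \<Rightarrow> real ^ 'n ^ 'n" where
  "sgn_diag x = (\<chi> i j. if i = j then sgn (x $ i) else 0)"

definition ave_residual :: "real ^ 'n ^ 'n \<Rightarrow> real ^ 'n \<Rightarrow> real ^ 'n \<Rightarrow> real ^ 'n" where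
  "ave_residual A b x = A *v x - \<bar>x\<bar> - b"

definition newton_step ::
  "(real ^ 'n \<Rightarrow> real) \<Rightarrow> real ^ 'n ^ 'n \<Rightarrow> real ^ 'n \<Rightarrow> real \<Rightarrow> real ^ 'n \<Rightarrow> real ^ 'n \<Rightarrow> bool" where
  "newton_step N A b \<theta> x y \<longleftrightarrow>
     N ((A - sgn_diag x) *v y - b) \<le> \<theta> * N (ave_residual A b x)"

definition newton_seq ::
  "(real ^ 'n \<Rightarrow> real) \<Rightarrow> real ^ 'n ^ 'n \<Rightarrow> real ^ 'n \<Rightarrow> real \<Rightarrow> (nat \<Rightarrow> real ^ 'n) \<Rightarrow> bool" where
  "newton_seq N A b \<theta> x \<longleftrightarrow> (\<forall>k. newton_step N A b \<theta> (x k) (x (Suc k)))"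

(* However x 0 = x0, ..., x k have been chosen, a next iterate exists; the values of x
   beyond k are irrelevant. *)
definition newton_well_defined ::
  "(real ^ 'n \<Rightarrow> real) \<Rightarrow> real ^ 'n ^ 'n \<Rightarrow> real ^ 'n \<Rightarrow> real \<Rightarrow> real ^ 'n \<Rightarrow> bool" where
  "newton_well_defined N A b \<theta> x0 \<longleftrightarrow>
     (\<forall>x k. x 0 = x0 \<and> (\<forall>j<k. newton_step N A b \<theta> (x j) (x (Suc j))) \<longrightarrow>
            (\<exists>y. newton_step N A b \<theta> (x k) y))"

definition Q_linear ::
  "(real ^ 'n \<Rightarrow> real) \<Rightarrow> (nat \<Rightarrow> real ^ 'n) \<Rightarrow> real ^ 'n \<Rightarrow> bool" where
  "Q_linear N x z \<longleftrightarrow>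
     ((\<lambda>k. N (x k - z)) \<longlonglongrightarrow> 0) \<and>
     (\<exists>c. 0 \<le> c \<and> c < 1 \<and> (\<forall>\<^sub>F k in sequentially. N (x (Suc k) - z) \<le> c * N (x k - z)))"

lemma is_norm_continuous:
  assumes "is_norm (N :: real ^ 'n \<Rightarrow> real)"
  shows "continuous_on S N"
proof -
  have tri: "N (x + y) \<le> N x + N y" and sc: "N (c *\<^sub>R x) = \<bar>c\<bar> * N x"
    and nn: "0 \<le> N x" for x y c
    using assms by (auto simp: is_norm_def)
  have N0: "N 0 = 0" using assms by (simp add: is_norm_def)
  have sumle: "N (\<Sum>i\<in>I. f i) \<le> (\<Sum>i\<in>I. N (f i))" if "finite I" for I and f :: "'n \<Rightarrow> real ^ 'n"
    using that
  proof (induction I rule: finite_induct)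
    case empty
    then show ?case by (simp add: N0)
  next
    case (insert i I)
    then show ?case using tri[of "f i" "sum f I"] by simp
  qed
  define K where "K = (\<Sum>i\<in>UNIV. N (axis i 1 :: real ^ 'n))"
  have bd: "N x \<le> K * norm x" for x
  proof -
    have "x = (\<Sum>i\<in>UNIV. (x $ i) *\<^sub>R axis i 1)"
      using basis_expansion[of x] by (simp add: scalar_mult_eq_scaleR)
    then have "N x \<le> (\<Sum>i\<in>UNIV. N ((x $ i) *\<^sub>R axis i 1))"
      using sumle[of UNIV "\<lambda>i. (x $ i) *\<^sub>R axis i 1"] by simp
    also have "\<dots> \<le> (\<Sum>i\<in>UNIV. norm x * N (axis i 1))"
      unfolding sc by (intro sum_mono mult_right_mono component_le_norm_cart nn)
    finally show ?thesis by (simp add: K_def sum_distrib_left mult.commute)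
  qed
  have K: "0 \<le> K" by (simp add: K_def nn sum_nonneg)
  have lip: "dist (N x) (N y) \<le> K * dist x y" for x y
  proof -
    have "N (y - x) = N (x - y)" using sc[of "-1" "x - y"] by simp
    moreover have "N x \<le> N (x - y) + N y" "N y \<le> N (y - x) + N x"
      using tri[of "x - y" y] tri[of "y - x" x] by simp_all
    ultimately show ?thesis using bd[of "x - y"] by (simp add: dist_norm abs_le_iff)
  qed
  have "K-lipschitz_on S N"
    using lip K by (intro lipschitz_onI) auto
  then show ?thesis by (rule lipschitz_on_continuous_on)
qed

lemma is_norm_compact_sphere:
  assumes "is_norm (N :: real ^ 'n \<Rightarrow> real)"
  shows "compact {x. N x = 1}"
proof -
  have sc: "N (c *\<^sub>R x) = \<bar>c\<bar> * N x" and nn: "0 \<le> N x" and z: "N x = 0 \<longleftrightarrow> x = 0" for x c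
    using assms by (auto simp: is_norm_def)
  obtain e where e: "norm e = 1" "\<And>y. norm y = 1 \<Longrightarrow> N e \<le> N y"
    using continuous_attains_inf[OF compact_sphere _ is_norm_continuous[OF assms], of 0 1]
    by (auto simp: dist_norm)
  have pos: "0 < N e" using e(1) nn[of e] z[of e] by force
  have "norm x \<le> 1 / N e" if "N x = 1" for x
  proof -
    have "x \<noteq> 0" using that z[of x] by auto
    then have "N e \<le> N (x /\<^sub>R norm x)" by (intro e(2)) simp
    also have "\<dots> = 1 / norm x" using that by (simp add: sc field_simps)
    finally show ?thesis using pos \<open>x \<noteq> 0\<close> by (simp add: field_simps)
  qed
  then have "bounded {x. N x = 1}" by (auto simp: bounded_iff)
  moreover have "closed {x. N x = 1}"
    by (intro closed_Collect_eq is_norm_continuous assms continuous_on_const)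
  ultimately show ?thesis by (simp add: compact_eq_bounded_closed)
qed

lemma mat_norm_attained:
  assumes "is_norm (N :: real ^ 'n \<Rightarrow> real)"
  shows "\<exists>x. N x = 1 \<and> mat_norm N M = N (M *v x) \<and> (\<forall>y. N y = 1 \<longrightarrow> N (M *v y) \<le> N (M *v x))"
proof -
  have sc: "N (c *\<^sub>R x) = \<bar>c\<bar> * N x" and nn: "0 \<le> N x" and z: "N x = 0 \<longleftrightarrow> x = 0" for x c
    using assms by (auto simp: is_norm_def)
  define u :: "real ^ 'n" where "u = vec 1"
  have "N u \<noteq> 0" by (simp add: z u_def vec_eq_iff)
  then have "N ((1 / N u) *\<^sub>R u) = 1" using nn[of u] by (simp add: sc)
  then have ne: "{x. N x = 1} \<noteq> {}" by blast
  have "continuous_on {x. N x = 1} (\<lambda>x. N (M *v x))"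
    by (rule continuous_on_compose2[OF is_norm_continuous[OF assms, of UNIV]])
       (auto intro: linear_continuous_on matrix_vector_mul_bounded_linear)
  from continuous_attains_sup[OF is_norm_compact_sphere[OF assms] ne this]
  obtain x where x: "N x = 1" "\<And>y. N y = 1 \<Longrightarrow> N (M *v y) \<le> N (M *v x)" by auto
  then have "mat_norm N M = N (M *v x)"
    unfolding mat_norm_def by (intro cSup_eq_maximum) auto
  then show ?thesis using x by blast
qed

end

theory Submission
  imports Defs
begin

text \<open>
  The induced operator norm of every matrix \<open>D x\<close> is at most 1, because an absolute norm is
  monotone: damping one coordinate by a factor \<open>t \<in> [-1, 1]\<close> yields a convex combination of the
  vector and its mirror image in that coordinate, which have the same norm. Hence
  \<open>z \<mapsto> A\<^sup>-\<^sup>1 (\<bar>z\<bar> + b)\<close> is a contraction, and \<open>A - D x\<close> is injective with inverse bounded by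
  \<open>\<parallel>A\<^sup>-\<^sup>1\<parallel> / (1 - \<parallel>A\<^sup>-\<^sup>1\<parallel>)\<close>. The error of a step satisfies
  \<open>(A - D x) (y - x\<^sub>*) = r + D x (x\<^sub>* - x) + (\<bar>x\<bar> - \<bar>x\<^sub>*\<bar>)\<close>, where \<open>r\<close> is the residual.
\<close>

section \<open>Norms and induced matrix norms\<close>

lemma is_normD:
  assumes "is_norm N"
  shows is_norm_nonneg: "0 \<le> N x"
    and is_norm_eq_0: "N x = 0 \<longleftrightarrow> x = 0"
    and is_norm_scaleR: "N (c *\<^sub>R x) = \<bar>c\<bar> * N x"
    and is_norm_triangle: "N (x + y) \<le> N x + N y"
  using assms by (auto simp: is_norm_def)

lemma is_norm_minus:
  assumes "is_norm N"
  shows "N (- x) = N x"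
  using is_norm_scaleR[OF assms, of "-1" x] by simp

lemma is_norm_triangle_diff:
  assumes "is_norm N"
  shows "N (x - y) \<le> N x + N y"
  using is_norm_triangle[OF assms, of x "- y"] is_norm_minus[OF assms, of y] by simp

lemma mat_norm_bound:
  assumes "is_norm N"
  shows "N (M *v x) \<le> mat_norm N M * N x"
proof (cases "x = 0")
  case True
  then show ?thesis using is_norm_eq_0[OF assms, of 0] by simp
next
  case False
  then have pos: "0 < N x"
    using is_norm_nonneg[OF assms, of x] is_norm_eq_0[OF assms, of x] by force
  define y where "y = (1 / N x) *\<^sub>R x"
  have "N y = 1" using pos by (simp add: y_def is_norm_scaleR[OF assms])
  then have "N (M *v y) \<le> mat_norm N M"
    using mat_norm_attained[OF assms, of M] by auto
  moreover have "N (M *v y) = N (M *v x) / N x"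
    using pos by (simp add: y_def matrix_vector_mult_scaleR is_norm_scaleR[OF assms])
  ultimately show ?thesis using pos by (simp add: field_simps)
qed

lemma mat_norm_nonneg:
  assumes "is_norm N"
  shows "0 \<le> mat_norm N M"
  using mat_norm_attained[OF assms, of M] is_norm_nonneg[OF assms] by metis

text \<open>Boundedness follows from that of the unit sphere by scaling. The compactness provides
  the minimiser in \<open>is_norm_contraction_fixpoint\<close>.\<close>

lemma is_norm_compact_ball:
  assumes "is_norm N"
  shows "compact {x. N x \<le> R}"
proof -
  obtain B where B: "norm u \<le> B" if "N u = 1" for u
    using compact_imp_bounded[OF is_norm_compact_sphere[OF assms]]
    by (auto simp: bounded_iff)
  \<comment> \<open>The absolute values keep the bound nonnegative, as the case \<open>x = 0\<close>
    requires whatever the signs of \<open>R\<close> and \<open>B\<close>.\<close>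
  have "norm x \<le> \<bar>R\<bar> * \<bar>B\<bar>" if "N x \<le> R" for x
  proof (cases "x = 0")
    case False
    then have pos: "0 < N x"
      using is_norm_nonneg[OF assms, of x] is_norm_eq_0[OF assms, of x] by force
    have "norm ((1 / N x) *\<^sub>R x) \<le> B"
      using pos by (intro B) (simp add: is_norm_scaleR[OF assms])
    then have "norm x \<le> N x * B" using pos by (simp add: field_simps)
    also have "\<dots> \<le> N x * \<bar>B\<bar>" using pos by simp
    also have "\<dots> \<le> \<bar>R\<bar> * \<bar>B\<bar>" using that by (intro mult_right_mono) auto
    finally show ?thesis .
  qed simp
  then have "bounded {x. N x \<le> R}" by (auto simp: bounded_iff)
  moreover have "closed {x. N x \<le> R}"
    by (intro closed_Collect_le is_norm_continuous assms continuous_on_const)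
  ultimately show ?thesis by (simp add: compact_eq_bounded_closed)
qed

section \<open>Absolute norms\<close>

lemma absolute_norm_mono:
  fixes x y :: "real ^ 'n"
  assumes N: "is_norm N" "absolute N" and le: "\<And>i. \<bar>x $ i\<bar> \<le> \<bar>y $ i\<bar>"
  shows "N x \<le> N y"
proof -
  \<comment> \<open>\<open>damp\<close> leads from \<open>y\<close> at the empty set to
    \<open>x\<close> at \<open>UNIV\<close>, changing one coordinate per insertion.\<close>
  define damp where "damp S = (\<chi> i. if i \<in> S then x $ i else y $ i)" for S :: "'n set"
  have "N (damp S) \<le> N y" if "finite S" for S
    using that
  proof (induction S rule: finite_induct)
    case empty
    then show ?case by (simp add: damp_def)
  next
    case (insert i S)
    obtain t where t: "\<bar>t\<bar> \<le> 1" "x $ i = t * y $ i"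
    proof
      \<comment> \<open>If \<open>y $ i = 0\<close>, then \<open>le\<close> forces
        \<open>x $ i = 0\<close>, so the factor 0 serves.\<close>
      show "\<bar>if y $ i = 0 then 0 else x $ i / y $ i\<bar> \<le> 1"
        using le[of i] by (simp add: divide_le_eq)
      show "x $ i = (if y $ i = 0 then 0 else x $ i / y $ i) * y $ i"
        using le[of i] by auto
    qed
    define v where "v = damp S"
    define w where "w = (\<chi> j. if j = i then - v $ j else v $ j)"
    have vi: "v $ i = y $ i" using insert by (simp add: v_def damp_def)
    have "\<bar>w\<bar> = \<bar>v\<bar>" by (simp add: w_def abs_vec_def vec_eq_iff)
    then have wv: "N w = N v" using N(2) unfolding absolute_def by metis
    \<comment> \<open>The weights are nonnegative with sum 1. Their difference is \<open>t\<close>,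
      which is the factor that coordinate \<open>i\<close> receives because \<open>w\<close> has it
      negated.\<close>
    have "damp (insert i S) = ((1 + t) / 2) *\<^sub>R v + ((1 - t) / 2) *\<^sub>R w"
    proof -
      have "damp (insert i S) $ j = (if j = i then t * v $ i else v $ j)" for j
        using t(2) vi by (auto simp: v_def damp_def)
      then show ?thesis by (auto simp: vec_eq_iff w_def field_simps)
    qed
    then have "N (damp (insert i S)) \<le> \<bar>(1 + t) / 2\<bar> * N v + \<bar>(1 - t) / 2\<bar> * N w"
      by (metis is_norm_triangle[OF N(1)] is_norm_scaleR[OF N(1)])
    also have "\<dots> = N v" using t(1) by (simp add: wv field_simps abs_le_iff)
    finally show ?case using insert.IH by (simp add: v_def)
  qed
  from this[of UNIV] show ?thesis by (simp add: damp_def)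
qed

lemma sgn_diag_mult_component: "(sgn_diag x *v y) $ i = sgn (x $ i) * y $ i"
  by (simp add: sgn_diag_def matrix_vector_mult_def if_distrib if_distribR cong: if_cong)

text \<open>This makes the linearisation exact at the current iterate:
  \<open>(A - sgn_diag x) *v x - b\<close> is \<open>ave_residual A b x\<close>.\<close>

lemma sgn_diag_mult_self: "sgn_diag x *v x = \<bar>x\<bar>"
  by (simp add: vec_eq_iff sgn_diag_mult_component abs_vec_def abs_sgn mult.commute)

text \<open>Absoluteness of the norm enters the later estimates through this bound and
  \<open>absolute_norm_abs_diff_le\<close>.\<close>

lemma absolute_norm_sgn_diag_le:
  assumes "is_norm N" "absolute N"
  shows "N (sgn_diag x *v y) \<le> N y"
  by (rule absolute_norm_mono[OF assms])
     (auto simp: sgn_diag_mult_component abs_mult sgn_if)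

lemma absolute_norm_abs_diff_le:
  assumes "is_norm N" "absolute N"
  shows "N (\<bar>x\<bar> - \<bar>y\<bar>) \<le> N (x - y)"
  by (rule absolute_norm_mono[OF assms]) (auto simp: abs_vec_def)

section \<open>Solvability of the Newton systems\<close>

lemma matrix_inv_mult_vec:
  fixes A :: "real ^ 'n ^ 'n"
  assumes "invertible A"
  shows "matrix_inv A *v (A *v x) = x" "A *v (matrix_inv A *v x) = x"
proof -
  have "A ** matrix_inv A = mat 1 \<and> matrix_inv A ** A = mat 1"
    using assms unfolding invertible_def matrix_inv_def by (rule someI_ex)
  then show "matrix_inv A *v (A *v x) = x" "A *v (matrix_inv A *v x) = x"
    by (simp_all add: matrix_vector_mul_assoc)
qed

text \<open>Let \<open>w\<close> be the image of \<open>y\<close> and \<open>a\<close> the norm of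
  the inverse. Moving the diagonal term to the other side and inverting \<open>A\<close> gives
  \<open>N y \<le> a * (N w + N y)\<close>, which is solved for \<open>N y\<close> as
  \<open>a < 1\<close>. This serves both injectivity and the error estimate.\<close>

lemma sgn_diag_perturbation_bound:
  fixes A :: "real ^ 'n ^ 'n"
  assumes N: "is_norm N" "absolute N" and A: "invertible A"
    and lt1: "mat_norm N (matrix_inv A) < 1"
  shows "N y \<le> mat_norm N (matrix_inv A) / (1 - mat_norm N (matrix_inv A))
    * N ((A - sgn_diag x) *v y)"
proof -
  define a where "a = mat_norm N (matrix_inv A)"
  define w where "w = (A - sgn_diag x) *v y"
  have "A *v y = w + sgn_diag x *v y"
    by (simp add: w_def matrix_vector_mult_diff_rdistrib)
  then have "N y = N (matrix_inv A *v (w + sgn_diag x *v y))"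
    by (metis matrix_inv_mult_vec(1)[OF A])
  also have "\<dots> \<le> a * N (w + sgn_diag x *v y)"
    unfolding a_def by (rule mat_norm_bound[OF N(1)])
  also have "\<dots> \<le> a * (N w + N y)"
    using is_norm_triangle[OF N(1), of w "sgn_diag x *v y"]
      absolute_norm_sgn_diag_le[OF N, of x y] mat_norm_nonneg[OF N(1)]
    by (intro mult_left_mono) (auto simp: a_def)
  finally show ?thesis
    using lt1 by (simp add: a_def[symmetric] w_def[symmetric] field_simps)
qed

text \<open>The exact Newton step has residual zero and so meets every tolerance
  \<open>\<theta> \<ge> 0\<close>.\<close>

lemma newton_well_definedI:
  fixes A :: "real ^ 'n ^ 'n"
  assumes N: "is_norm N" "absolute N" and A: "invertible A"
    and lt1: "mat_norm N (matrix_inv A) < 1" and \<theta>: "0 \<le> \<theta>"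
  shows "newton_well_defined N A b \<theta> x0"
proof -
  have "\<exists>y. newton_step N A b \<theta> x y" for x
  proof -
    have "y = 0" if "(A - sgn_diag x) *v y = 0" for y
      using sgn_diag_perturbation_bound[OF N A lt1, of y x] that
        is_norm_eq_0[OF N(1), of 0] is_norm_eq_0[OF N(1), of y] is_norm_nonneg[OF N(1), of y]
      by simp
    then have "invertible (A - sgn_diag x)"
      by (simp add: invertible_left_inverse matrix_left_invertible_ker)
    then have "(A - sgn_diag x) *v (matrix_inv (A - sgn_diag x) *v b) - b = 0"
      by (simp add: matrix_inv_mult_vec)
    then have "newton_step N A b \<theta> x (matrix_inv (A - sgn_diag x) *v b)"
      unfolding newton_step_def
      using is_norm_eq_0[OF N(1), of 0] is_norm_nonneg[OF N(1)] \<theta> by simp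
    then show ?thesis ..
  qed
  then show ?thesis by (simp add: newton_well_defined_def)
qed

section \<open>Unique solvability of the equation\<close>

text \<open>
  The contraction is with respect to \<open>N\<close>, whereas the library's Banach fixed point theorem is about
  \<open>dist\<close>; minimising \<open>N (f z - z)\<close> over an invariant ball avoids comparing the two norms.
\<close>
lemma is_norm_contraction_fixpoint:
  assumes N: "is_norm N" and a: "0 \<le> a" "a < 1"
    and f: "\<And>x y. N (f x - f y) \<le> a * N (x - y)" and cont: "continuous_on UNIV f"
  shows "\<exists>!z. f z = z"
proof (rule ex_ex1I)
  \<comment> \<open>\<open>R\<close> is the fixed point of
    \<open>s \<mapsto> a * s + N (f 0)\<close>, so \<open>f\<close> maps the ball of radius
    \<open>R\<close> into itself.\<close>
  define R where "R = N (f 0) / (1 - a)"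
  have "0 \<le> R" using a is_norm_nonneg[OF N] by (simp add: R_def)
  have R: "a * R + N (f 0) = R" using a by (simp add: R_def field_simps)
  have ball: "N (f x) \<le> R" if "N x \<le> R" for x
  proof -
    have "N (f x) \<le> N (f x - f 0) + N (f 0)"
      using is_norm_triangle[OF N, of "f x - f 0" "f 0"] by simp
    also have "\<dots> \<le> a * R + N (f 0)"
      using f[of x 0] mult_left_mono[OF that a(1)] by simp
    finally show ?thesis using R by simp
  qed
  have "continuous_on {x. N x \<le> R} (\<lambda>x. N (f x - x))"
    by (rule continuous_on_compose2[OF is_norm_continuous[OF N, of UNIV]])
       (intro continuous_on_diff continuous_on_id continuous_on_subset[OF cont] subset_UNIV)+
  moreover have "{x. N x \<le> R} \<noteq> {}"
    using \<open>0 \<le> R\<close> is_norm_eq_0[OF N, of 0] by (auto intro: exI[of _ 0])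
  ultimately obtain z where z: "N z \<le> R" "\<And>y. N y \<le> R \<Longrightarrow> N (f z - z) \<le> N (f y - y)"
    using continuous_attains_inf[OF is_norm_compact_ball[OF N], of R "\<lambda>x. N (f x - x)"] by auto
  \<comment> \<open>The minimiser is compared with \<open>f z\<close>, which lies in the ball and
    whose displacement is smaller by the factor \<open>a\<close>.\<close>
  have "N (f z - z) \<le> a * N (f z - z)"
    using z(2)[OF ball[OF z(1)]] f[of "f z" z] by linarith
  then have "N (f z - z) = 0"
    using a is_norm_nonneg[OF N, of "f z - z"]
    by (simp add: mult_le_cancel_right1 antisym)
  then show "\<exists>z. f z = z" using is_norm_eq_0[OF N] by auto
next
  fix y z
  assume "f y = y" "f z = z"
  then have "N (y - z) \<le> a * N (y - z)" using f[of y z] by simp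
  then have "N (y - z) = 0"
    using a is_norm_nonneg[OF N, of "y - z"]
    by (simp add: mult_le_cancel_right1 antisym)
  then show "y = z" using is_norm_eq_0[OF N] by auto
qed

lemma absolute_value_equation_unique_solution:
  fixes A :: "real ^ 'n ^ 'n"
  assumes N: "is_norm N" "absolute N" and A: "invertible A"
    and lt1: "mat_norm N (matrix_inv A) < 1"
  shows "\<exists>!z. A *v z - \<bar>z\<bar> = b"
proof -
  define f where "f z = matrix_inv A *v (\<bar>z\<bar> + b)" for z
  have "\<exists>!z. f z = z"
  proof (rule is_norm_contraction_fixpoint[OF N(1) mat_norm_nonneg[OF N(1)] lt1])
    fix x y
    have "N (f x - f y) = N (matrix_inv A *v (\<bar>x\<bar> - \<bar>y\<bar>))"
      by (simp add: f_def matrix_vector_mult_diff_distrib[symmetric])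
    also have "\<dots> \<le> mat_norm N (matrix_inv A) * N (\<bar>x\<bar> - \<bar>y\<bar>)"
      by (rule mat_norm_bound[OF N(1)])
    also have "\<dots> \<le> mat_norm N (matrix_inv A) * N (x - y)"
      by (intro mult_left_mono absolute_norm_abs_diff_le N mat_norm_nonneg)
    finally show "N (f x - f y) \<le> mat_norm N (matrix_inv A) * N (x - y)" .
  next
    have "continuous_on UNIV (\<lambda>z :: real ^ 'n. \<bar>z\<bar>)"
      unfolding abs_vec_def by (intro continuous_intros)
    then show "continuous_on UNIV f"
      unfolding f_def
      by (intro continuous_on_compose2[OF linear_continuous_on[OF matrix_vector_mul_bounded_linear, of UNIV]]
          continuous_intros) auto
  qed
  moreover have "f z = z \<longleftrightarrow> A *v z - \<bar>z\<bar> = b" for z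
    unfolding f_def by (metis matrix_inv_mult_vec[OF A] diff_add_cancel add_diff_cancel_left')
  ultimately show ?thesis by simp
qed

section \<open>Error estimate and convergence\<close>

text \<open>The factor \<open>mat_norm N A + 1\<close> is a Lipschitz constant of
  \<open>ave_residual A b\<close>, which vanishes at \<open>z\<close>. The 2 counts the two
  nonexpansive terms, one from \<open>sgn_diag x\<close> and one from the componentwise absolute
  value.\<close>

lemma newton_step_error:
  fixes A :: "real ^ 'n ^ 'n"
  assumes N: "is_norm N" "absolute N" and A: "invertible A"
    and lt1: "mat_norm N (matrix_inv A) < 1" and \<theta>: "0 \<le> \<theta>"
    and sol: "A *v z - \<bar>z\<bar> = b" and step: "newton_step N A b \<theta> x y"
  shows "N (y - z) \<le> mat_norm N (matrix_inv A) / (1 - mat_norm N (matrix_inv A))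
    * (\<theta> * (mat_norm N A + 1) + 2) * N (x - z)"
proof -
  define D where "D = sgn_diag x"
  define r where "r = (A - D) *v y - b"
  have zb: "A *v z = \<bar>z\<bar> + b" using sol by (simp add: algebra_simps)
  have res: "N (ave_residual A b x) \<le> (mat_norm N A + 1) * N (x - z)"
  proof -
    have "ave_residual A b x = A *v (x - z) - (\<bar>x\<bar> - \<bar>z\<bar>)"
      by (simp add: ave_residual_def matrix_vector_mult_diff_distrib zb)
    then have "N (ave_residual A b x) \<le> N (A *v (x - z)) + N (\<bar>x\<bar> - \<bar>z\<bar>)"
      by (simp only: is_norm_triangle_diff[OF N(1)])
    also have "\<dots> \<le> mat_norm N A * N (x - z) + N (x - z)"
      by (intro add_mono mat_norm_bound absolute_norm_abs_diff_le N)
    finally show ?thesis by (simp add: algebra_simps)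
  qed
  have r: "N r \<le> \<theta> * ((mat_norm N A + 1) * N (x - z))"
    using step mult_left_mono[OF res \<theta>] by (simp add: newton_step_def r_def D_def)
  \<comment> \<open>The terms \<open>D *v x\<close> and \<open>\<bar>x\<bar>\<close> cancel; they
    are inserted so that every summand is controlled by \<open>x - z\<close>.\<close>
  have "(A - D) *v (y - z) = r - (D *v (x - z) - (\<bar>x\<bar> - \<bar>z\<bar>))"
    using sgn_diag_mult_self[of x]
    by (simp add: r_def D_def matrix_vector_mult_diff_distrib matrix_vector_mult_diff_rdistrib zb)
  then have "N ((A - D) *v (y - z)) = N (r - (D *v (x - z) - (\<bar>x\<bar> - \<bar>z\<bar>)))"
    by (rule arg_cong)
  then have "N ((A - D) *v (y - z)) \<le> N r + (N (D *v (x - z)) + N (\<bar>x\<bar> - \<bar>z\<bar>))"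
    using is_norm_triangle_diff[OF N(1), of r "D *v (x - z) - (\<bar>x\<bar> - \<bar>z\<bar>)"]
      is_norm_triangle_diff[OF N(1), of "D *v (x - z)" "\<bar>x\<bar> - \<bar>z\<bar>"] by linarith
  also have "\<dots> \<le> (\<theta> * (mat_norm N A + 1) + 2) * N (x - z)"
    using r absolute_norm_sgn_diag_le[OF N, of x "x - z"] absolute_norm_abs_diff_le[OF N, of x z]
    unfolding D_def distrib_right mult.assoc by linarith
  finally have "N ((A - D) *v (y - z)) \<le> (\<theta> * (mat_norm N A + 1) + 2) * N (x - z)" .
  then have "mat_norm N (matrix_inv A) / (1 - mat_norm N (matrix_inv A)) * N ((A - D) *v (y - z))
    \<le> mat_norm N (matrix_inv A) / (1 - mat_norm N (matrix_inv A))
      * ((\<theta> * (mat_norm N A + 1) + 2) * N (x - z))"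
    using lt1 mat_norm_nonneg[OF N(1), of "matrix_inv A"] by (intro mult_left_mono) auto
  with sgn_diag_perturbation_bound[OF N A lt1, of "y - z" x] show ?thesis
    unfolding D_def mult.assoc by linarith
qed

lemma Q_linearI:
  assumes N: "is_norm N" and c: "0 \<le> c" "c < 1"
    and step: "\<And>k. N (x (Suc k) - z) \<le> c * N (x k - z)"
  shows "Q_linear N x z"
proof -
  have "N (x k - z) \<le> c ^ k * N (x 0 - z)" for k
  proof (induction k)
    case (Suc k)
    then show ?case using step[of k] mult_left_mono[OF Suc c(1)] by (simp add: mult.assoc)
  qed simp
  then have "norm (N (x k - z)) \<le> c ^ k * N (x 0 - z)" for k
    using is_norm_nonneg[OF N, of "x k - z"] by simp
  moreover have "(\<lambda>k. c ^ k * N (x 0 - z)) \<longlonglongrightarrow> 0"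
    using c by (intro tendsto_mult_left_zero LIMSEQ_realpow_zero) auto
  ultimately have "(\<lambda>k. N (x k - z)) \<longlonglongrightarrow> 0"
    by (rule Lim_null_comparison[OF always_eventually[OF allI]])
  then show ?thesis using c step by (auto simp: Q_linear_def)
qed

theorem theorem2:
  fixes A :: "real ^ 'n ^ 'n" and b :: "real ^ 'n"
    and N :: "real ^ 'n \<Rightarrow> real" and \<theta> :: real
  assumes "is_norm N" and "absolute N"
    and "invertible A"
    and "mat_norm N (matrix_inv A) < 1 / 3"
    and "0 \<le> \<theta>"
  shows "(\<forall>x0. newton_well_defined N A b \<theta> x0) \<and>
    (\<theta> < (1 - 3 * mat_norm N (matrix_inv A)) / (mat_norm N (matrix_inv A) * (mat_norm N A + 3)) \<longrightarrow>
      (\<exists>xs. (\<forall>z. A *v z - \<bar>z\<bar> = b \<longleftrightarrow> z = xs) \<and>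
        (\<forall>x. newton_seq N A b \<theta> x \<longrightarrow>
          Q_linear N x xs \<and>
          (\<forall>k. N (x (Suc k) - xs) \<le>
             mat_norm N (matrix_inv A) / (1 - mat_norm N (matrix_inv A)) *
               (\<theta> * (mat_norm N A + 3) + 2) * N (x k - xs)))))"
proof (intro conjI impI allI)
  have lt1: "mat_norm N (matrix_inv A) < 1" using assms(4) by simp
  show "newton_well_defined N A b \<theta> x0" for x0
    using newton_well_definedI assms lt1 by blast
  define a where "a = mat_norm N (matrix_inv A)"
  define m where "m = mat_norm N A"
  define c where "c = a / (1 - a) * (\<theta> * (m + 3) + 2)"
  have a: "0 \<le> a" "a < 1 / 3" and m: "0 \<le> m"
    using assms(4) mat_norm_nonneg[OF assms(1)] by (auto simp: a_def m_def)
  have c0: "0 \<le> c" using a m assms(5) by (simp add: c_def)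
  assume "\<theta> < (1 - 3 * mat_norm N (matrix_inv A)) / (mat_norm N (matrix_inv A) * (mat_norm N A + 3))"
  then have \<theta>: "\<theta> < (1 - 3 * a) / (a * (m + 3))" by (simp add: a_def m_def)
  \<comment> \<open>For \<open>a = 0\<close> the bound on \<open>\<theta>\<close> is the junk value \<open>0\<close>.\<close>
  then have "0 < a" using a assms(5) by (cases "a = 0") auto
  then have "\<theta> * (a * (m + 3)) < 1 - 3 * a"
    using \<theta> m by (simp add: pos_less_divide_eq)
  \<comment> \<open>The threshold on \<open>\<theta>\<close> is exactly \<open>c < 1\<close>,
    cleared of the denominator \<open>1 - a\<close>.\<close>
  then have "a * (\<theta> * (m + 3) + 2) < 1 - a" by (simp add: algebra_simps)
  then have c1: "c < 1" using a by (simp add: c_def)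
  obtain xs where xs: "A *v z - \<bar>z\<bar> = b \<longleftrightarrow> z = xs" for z
    using absolute_value_equation_unique_solution[OF assms(1-3) lt1, of b] by metis
  have step: "N (x (Suc k) - xs) \<le> c * N (x k - xs)" if "newton_seq N A b \<theta> x" for x k
  proof -
    have "N (x (Suc k) - xs) \<le> a / (1 - a) * (\<theta> * (m + 1) + 2) * N (x k - xs)"
      unfolding a_def m_def using xs that
      by (intro newton_step_error[OF assms(1-3) lt1 assms(5), of _ b]) (auto simp: newton_seq_def)
    \<comment> \<open>The one-step estimate has \<open>m + 1\<close>; enlarging it to
      \<open>m + 3\<close> gives the stated constant.\<close>
    also have "\<dots> \<le> c * N (x k - xs)"
      unfolding c_def using a assms(5)
      by (intro mult_right_mono mult_left_mono add_right_mono is_norm_nonneg[OF assms(1)]) auto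
    finally show ?thesis .
  qed
  show "\<exists>xs. (\<forall>z. A *v z - \<bar>z\<bar> = b \<longleftrightarrow> z = xs) \<and>
        (\<forall>x. newton_seq N A b \<theta> x \<longrightarrow>
          Q_linear N x xs \<and>
          (\<forall>k. N (x (Suc k) - xs) \<le>
             mat_norm N (matrix_inv A) / (1 - mat_norm N (matrix_inv A)) *
               (\<theta> * (mat_norm N A + 3) + 2) * N (x k - xs)))"
    using xs step Q_linearI[OF assms(1) c0 c1]
    by (intro exI[of _ xs]) (simp add: c_def a_def m_def)
qed

end
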